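(* Let $V$ be a vector space of finite dimension $n$ over a field $\mathbb K$, let $3\le k<n-1$ with $n-k$ even, and let $H$ be a hyperplane of $\mathcal G_k(V)$. Then $R^\uparrow(H)=\emptyset$ if and only if, for every hyperplane $W$ of $V$ (subspace of dimension $n-1$), $R^\uparrow(H(W))$ is spread-like.
   Context: For $1\le k<n=\dim V$, $\mathcal G_k(V)$ is the point-line geometry whose points are the $k$-dimensional subspaces of $V$ and whose lines are the sets $\{X : Y\subset X\subset Z,\ \dim X=k\}$ with $Y\subset Z$ subspaces of $V$, $\dim Y=k-1$, $\dim Z=k+1$. A subspace of $\mathcal G_k(V)$ is a set $S$ of points containing every line that meets $S$ in at least two points; a hyperplane of $\mathcal G_k(V)$ is a proper subspace meeting every line non-trivially. It is known (Shult) that the hyperplanes of $\mathcal G_k(V)$ are exactly the sets of $k$-subspaces of $V$ on which a given non-trivial alternating $k$-linear form $\varphi$ on $V$ identically vanishes, $\varphi$ being unique up to a non-zero scalar. The upper radical $R^\uparrow(H)$ is the set of $(k-1)$-dimensional subspaces $A$ of $V$ such that every $k$-dimensional subspace of $V$ containing $A$ belongs to $H$. For a subspace $W$ of $V$, $G_k(W)$ is the set of $k$-dimensional subspaces of $W$ and $H(W):=H\cap G_k(W)$. The upper radical $R^\uparrow(H(W))$ is computed inside $W$: it is the set of $(k-1)$-dimensional subspaces $A$ of $W$ such that every $k$-dimensional subspace of $W$ containing $A$ belongs to $H(W)$. It is called spread-like if every $(k-2)$-dimensional subspace of $W$ is contained in exactly one member of $R^\uparrow(H(W))$. *)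

theory Defs
  imports Complex_Main
begin

definition geometry_subspace :: "'p set \<Rightarrow> 'p set set \<Rightarrow> 'p set \<Rightarrow> bool" where
  "geometry_subspace P L S \<longleftrightarrow>
     S \<subseteq> P \<and> (\<forall>l\<in>L. (\<exists>x\<in>l \<inter> S. \<exists>y\<in>l \<inter> S. x \<noteq> y) \<longrightarrow> l \<subseteq> S)"

definition geometry_hyperplane :: "'p set \<Rightarrow> 'p set set \<Rightarrow> 'p set \<Rightarrow> bool" where
  "geometry_hyperplane P L H \<longleftrightarrow>
     geometry_subspace P L H \<and> H \<noteq> P \<and> (\<forall>l\<in>L. l \<inter> H \<noteq> {})"

text \<open>
  The ambient vector space is the whole type, i.e. \<open>V = UNIV\<close>; all constructions
  take a subspace \<open>W\<close> as a parameter so that they can also be carried out inside \<open>W\<close>.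
  The natural subtractions \<open>k - 1\<close> and \<open>k - 2\<close> below are meant for \<open>k \<ge> 1\<close> and \<open>k \<ge> 2\<close>.
\<close>

definition (in vector_space) grassmannian :: "nat \<Rightarrow> 'b set \<Rightarrow> 'b set set" where
  "grassmannian k W = {X. subspace X \<and> X \<subseteq> W \<and> dim X = k}"

definition (in vector_space) grassmann_lines :: "nat \<Rightarrow> 'b set \<Rightarrow> 'b set set set" where
  "grassmann_lines k W =
     {{X \<in> grassmannian k W. Y \<subseteq> X \<and> X \<subseteq> Z} | Y Z.
        Y \<in> grassmannian (k - 1) W \<and> Z \<in> grassmannian (k + 1) W \<and> Y \<subseteq> Z}"

definition (in vector_space) grassmann_hyperplane :: "nat \<Rightarrow> 'b set \<Rightarrow> 'b set set \<Rightarrow> bool" where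
  "grassmann_hyperplane k W H \<longleftrightarrow>
     geometry_hyperplane (grassmannian k W) (grassmann_lines k W) H"

definition (in vector_space) restrict_to :: "nat \<Rightarrow> 'b set set \<Rightarrow> 'b set \<Rightarrow> 'b set set" where
  "restrict_to k H W = H \<inter> grassmannian k W"

definition (in vector_space) upper_radical :: "nat \<Rightarrow> 'b set \<Rightarrow> 'b set set \<Rightarrow> 'b set set" where
  "upper_radical k W H =
     {A \<in> grassmannian (k - 1) W. \<forall>X\<in>grassmannian k W. A \<subseteq> X \<longrightarrow> X \<in> H}"

definition (in vector_space) spread_like :: "nat \<Rightarrow> 'b set \<Rightarrow> 'b set set \<Rightarrow> bool" where
  "spread_like k W R \<longleftrightarrow> (\<forall>B\<in>grassmannian (k - 2) W. \<exists>!A. A \<in> R \<and> B \<subseteq> A)"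

end

theory Submission
  imports Defs
begin

text \<open>
  Fix a subspace \<open>B\<close> of dimension \<open>k - 2\<close> and call two vectors \<open>x\<close>, \<open>y\<close> perpendicular when
  \<open>B\<close>, \<open>x\<close>, \<open>y\<close> together span either a member of \<open>H\<close> or something of dimension below \<open>k\<close>. For the
  alternating form \<open>\<phi>\<close> defining \<open>H\<close> this is the vanishing of the bilinear form \<open>\<phi>(B, x, y)\<close>. The
  two axioms of a geometric hyperplane, applied to lines through a fixed \<open>(k - 1)\<close>-space, say
  directly that all the sets \<open>x\<^sup>\<bottom>\<close> are subspaces of codimension at most one
  (\<open>null_polarity_residue\<close>). Hence hyperbolic pairs can be split off as for an alternating form, and
  a subspace and its radical have dimensions of the same parity (\<open>even_dim_diff_radical\<close>).

  For \<open>B \<subseteq> W\<close>, the members of \<open>R\<^sup>\<up>(H(W))\<close> through \<open>B\<close> are the \<open>(k - 1)\<close>-spaces between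
  \<open>B\<close> and the radical of \<open>W\<close> (\<open>mem_upper_radical_iff\<close>). The theorem then is parity counting.
  The dimension \<open>n - 1\<close> of a hyperplane \<open>W\<close> has the parity of \<open>k - 1\<close>, so the radical of \<open>W\<close> is
  larger than \<open>B\<close> and some member of \<open>R\<^sup>\<up>(H(W))\<close> contains \<open>B\<close>. Two different ones would make the
  radical of \<open>W\<close> exceed \<open>B\<close> by two dimensions, and for \<open>v \<notin> W\<close> the condition of being
  perpendicular to \<open>v\<close> would cut out a vector outside \<open>B\<close> that is perpendicular to all of \<open>V\<close>; this gives a
  member of \<open>R\<^sup>\<up>(H)\<close>. Conversely, if \<open>A \<in> R\<^sup>\<up>(H)\<close> and \<open>B \<subset> A\<close>, then the radical of
  \<open>V\<close> contains \<open>A\<close>, and since \<open>n\<close> has the parity of \<open>k\<close>, its dimension is at least \<open>k\<close>. A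
  hyperplane \<open>W\<close> through \<open>A\<close> and a further vector of this radical carries two members of
  \<open>R\<^sup>\<up>(H(W))\<close> through \<open>B\<close>.
\<close>

section \<open>Null polarities and the parity of their radicals\<close>

text \<open>
  These are the properties of the orthogonality relation of an alternating bilinear form that do not
  mention its values. The last one expresses, without dimensions, that \<open>x\<^sup>\<bottom>\<close> is everything or a
  hyperplane.
\<close>

locale null_polarity = finite_dimensional_vector_space scale Basis
  for scale :: "'k::field \<Rightarrow> 'v::ab_group_add \<Rightarrow> 'v" and Basis :: "'v set" +
  fixes perp :: "'v \<Rightarrow> 'v \<Rightarrow> bool"
  assumes perp_refl: "perp x x"
    and perp_sym: "perp x y \<Longrightarrow> perp y x"
    and subspace_perp: "subspace {y. perp x y}"
    and perp_codim: "\<not> perp x y \<Longrightarrow> \<exists>c. perp x (z - scale c y)"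
begin

definition radical :: "'v set \<Rightarrow> 'v set" where
  "radical U = {x \<in> U. \<forall>y\<in>U. perp x y}"

lemma perp_add: "perp x y \<Longrightarrow> perp x z \<Longrightarrow> perp x (y + z)"
  using subspace_perp[of x] by (auto simp: subspace_def)

lemma perp_diff: "perp x y \<Longrightarrow> perp x z \<Longrightarrow> perp x (y - z)"
  using subspace_diff[OF subspace_perp[of x]] by auto

lemma perp_scale: "perp x y \<Longrightarrow> perp x (scale c y)"
  using subspace_perp[of x] by (auto simp: subspace_def)

text \<open>
  A pair \<open>x\<close>, \<open>y\<close> that is not perpendicular spans a complement of \<open>{x, y}\<^sup>\<bottom>\<close>: a vector is moved
  into \<open>x\<^sup>\<bottom>\<close> by a multiple of \<open>y\<close>, and then into \<open>y\<^sup>\<bottom>\<close> by a multiple of \<open>x\<close>, which stays in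
  \<open>x\<^sup>\<bottom>\<close> because \<open>x\<close> is perpendicular to itself.
\<close>

lemma hyperbolic_decomposition:
  assumes "\<not> perp x y"
  obtains c d where "perp x (u - scale c y - scale d x)" "perp y (u - scale c y - scale d x)"
proof -
  obtain c where c: "perp x (u - scale c y)"
    using perp_codim[OF assms] by blast
  have "\<not> perp y x"
    using assms perp_sym by blast
  then obtain d where d: "perp y (u - scale c y - scale d x)"
    using perp_codim by blast
  have "perp x (u - scale c y - scale d x)"
    by (intro perp_diff c perp_scale perp_refl)
  with d that show thesis by blast
qed

text \<open>
  Splitting off a hyperbolic pair lowers the dimension by two and keeps the radical, so the
  codimension of the radical is twice the number of pairs that can be split off.
\<close>

lemma even_dim_diff_radical:
  assumes "subspace U"
  shows "even (dim U - dim (radical U))"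
  using assms
proof (induction "dim U" arbitrary: U rule: less_induct)
  case less
  show ?case
  proof (cases "radical U = U")
    case True
    then show ?thesis by simp
  next
    case False
    then obtain x y where x: "x \<in> U" and y: "y \<in> U" and nperp: "\<not> perp x y"
      by (auto simp: radical_def)
    define U' where "U' = U \<inter> {z. perp x z} \<inter> {z. perp y z}"
    have sub': "subspace U'"
      unfolding U'_def by (intro subspace_inter less.prems subspace_perp)
    have decomp: "\<exists>c d. u - scale c y - scale d x \<in> U'" if "u \<in> U" for u
    proof -
      obtain c d where "perp x (u - scale c y - scale d x)" "perp y (u - scale c y - scale d x)"
        using hyperbolic_decomposition[OF nperp] by blast
      moreover have "u - scale c y - scale d x \<in> U"
        using less.prems x y that by (intro subspace_diff subspace_scale)
      ultimately show ?thesis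
        by (auto simp: U'_def)
    qed
    have "U = span (insert x (insert y U'))"
    proof
      show "U \<subseteq> span (insert x (insert y U'))"
      proof
        fix u assume "u \<in> U"
        then obtain c d where "u - scale c y - scale d x \<in> U'"
          using decomp by blast
        then have "(u - scale c y - scale d x) + scale c y + scale d x
            \<in> span (insert x (insert y U'))"
          by (intro span_add span_scale) (auto intro: span_base)
        then show "u \<in> span (insert x (insert y U'))"
          by simp
      qed
      show "span (insert x (insert y U')) \<subseteq> U"
        using x y less.prems by (intro span_minimal) (auto simp: U'_def)
    qed
    moreover have "y \<notin> span U'"
      using nperp sub' by (auto simp: U'_def span_eq_iff[THEN iffD2])
    moreover have "x \<notin> span (insert y U')"
    proof
      assume "x \<in> span (insert y U')"
      moreover have "span (insert y U') \<subseteq> {z. perp y z}"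
        by (intro span_minimal subspace_perp) (auto simp: U'_def perp_refl)
      ultimately show False
        using nperp perp_sym by blast
    qed
    ultimately have dim: "dim U = dim U' + 2"
      by (metis dim_insert dim_span add.assoc one_add_one)
    have rad: "radical U' = radical U"
    proof
      show "radical U \<subseteq> radical U'"
        using x y by (auto simp: radical_def U'_def perp_sym)
      show "radical U' \<subseteq> radical U"
      proof
        fix r assume r: "r \<in> radical U'"
        have "perp r u" if u: "u \<in> U" for u
        proof -
          obtain c d where "u - scale c y - scale d x \<in> U'"
            using decomp u by blast
          then have "perp r (u - scale c y - scale d x)"
            using r by (auto simp: radical_def)
          moreover have "perp r x" "perp r y"
            using r by (auto simp: radical_def U'_def perp_sym)
          ultimately have "perp r ((u - scale c y - scale d x) + scale c y + scale d x)"
            by (intro perp_add perp_scale)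
          then show ?thesis by simp
        qed
        with r show "r \<in> radical U"
          by (auto simp: radical_def U'_def)
      qed
    qed
    have "even (dim U' - dim (radical U'))"
      using less.hyps sub' dim by simp
    moreover have "dim (radical U') \<le> dim U'"
      by (intro dim_subset) (auto simp: radical_def)
    ultimately show ?thesis
      by (simp add: rad dim)
  qed
qed

end

section \<open>The null polarity at a subspace of dimension k - 2\<close>

context vector_space
begin

lemma hyperplane_meets_pencil:
  assumes "grassmann_hyperplane k UNIV H" "A \<in> grassmannian (k - 1) UNIV"
    "Z \<in> grassmannian (k + 1) UNIV" "A \<subseteq> Z"
  obtains X where "X \<in> H" "X \<in> grassmannian k UNIV" "A \<subseteq> X" "X \<subseteq> Z"
proof -
  have "{X \<in> grassmannian k UNIV. A \<subseteq> X \<and> X \<subseteq> Z} \<in> grassmann_lines k UNIV"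
    unfolding grassmann_lines_def using assms(2-4) by blast
  then have "{X \<in> grassmannian k UNIV. A \<subseteq> X \<and> X \<subseteq> Z} \<inter> H \<noteq> {}"
    using assms(1) by (simp add: grassmann_hyperplane_def geometry_hyperplane_def)
  then show thesis using that by blast
qed

lemma hyperplane_contains_pencil:
  assumes "grassmann_hyperplane k UNIV H" "A \<in> grassmannian (k - 1) UNIV"
    "Z \<in> grassmannian (k + 1) UNIV"
    "X1 \<in> H" "A \<subseteq> X1" "X1 \<subseteq> Z" "X2 \<in> H" "A \<subseteq> X2" "X2 \<subseteq> Z" "X1 \<noteq> X2"
    "X \<in> grassmannian k UNIV" "A \<subseteq> X" "X \<subseteq> Z"
  shows "X \<in> H"
proof -
  let ?l = "{X \<in> grassmannian k UNIV. A \<subseteq> X \<and> X \<subseteq> Z}"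
  have l: "?l \<in> grassmann_lines k UNIV"
    unfolding grassmann_lines_def using assms(2,3,5,6) by blast
  have "H \<subseteq> grassmannian k UNIV"
    and lines: "\<forall>l\<in>grassmann_lines k UNIV. (\<exists>x\<in>l \<inter> H. \<exists>y\<in>l \<inter> H. x \<noteq> y) \<longrightarrow> l \<subseteq> H"
    using assms(1)
    by (simp_all add: grassmann_hyperplane_def geometry_hyperplane_def geometry_subspace_def)
  then have "X1 \<in> ?l \<inter> H" "X2 \<in> ?l \<inter> H"
    using assms(4-9) by blast+
  then have "?l \<subseteq> H"
    using bspec[OF lines l] assms(10) by meson
  then show ?thesis using assms(11-13) by blast
qed

definition residue_perp :: "nat \<Rightarrow> 'b set set \<Rightarrow> 'b set \<Rightarrow> 'b \<Rightarrow> 'b \<Rightarrow> bool" where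
  "residue_perp k H B x y \<longleftrightarrow>
     (dim (insert x (insert y B)) = k \<longrightarrow> span (insert x (insert y B)) \<in> H)"

lemma restrict_to_UNIV: "grassmann_hyperplane k UNIV H \<Longrightarrow> restrict_to k H UNIV = H"
  by (auto simp: restrict_to_def grassmann_hyperplane_def geometry_hyperplane_def
      geometry_subspace_def)

lemma span_insert_span: "span (insert y (span S)) = span (insert y S)"
proof
  have "span S \<subseteq> span (insert y S)"
    by (rule span_mono) auto
  then show "span (insert y (span S)) \<subseteq> span (insert y S)"
    by (intro span_minimal) (auto intro: span_base)
  show "span (insert y S) \<subseteq> span (insert y (span S))"
    by (rule span_mono) (auto intro: span_base)
qed

end

context finite_dimensional_vector_space
begin

lemma grassmannian_insert:
  assumes "A \<in> grassmannian k UNIV" "x \<notin> A"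
  shows "span (insert x A) \<in> grassmannian (Suc k) UNIV"
  using assms by (simp add: grassmannian_def dim_insert span_eq_iff[THEN iffD2])

lemma span_insert_eqI:
  assumes "A \<in> grassmannian k UNIV" "X \<in> grassmannian (Suc k) W" "A \<subseteq> X" "x \<in> X" "x \<notin> A"
  shows "span (insert x A) = X"
proof (rule subspace_dim_equal)
  show "span (insert x A) \<subseteq> X"
    using assms by (intro span_minimal) (auto simp: grassmannian_def)
  show "dim X \<le> dim (span (insert x A))"
    using grassmannian_insert[OF assms(1,5)] assms(2) by (simp add: grassmannian_def)
qed (use assms in \<open>auto simp: grassmannian_def\<close>)

lemma residue_perp_base:
  assumes "B \<in> grassmannian (k - 2) UNIV" "2 \<le> k" "b \<in> B"
  shows "residue_perp k H B b y"
  using assms by (auto simp: residue_perp_def grassmannian_def dim_insert insert_absorb)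

lemma residue_perp_iff:
  assumes "B \<in> grassmannian (k - 2) UNIV" "2 \<le> k" "x \<notin> B"
  shows "residue_perp k H B x y \<longleftrightarrow>
    y \<in> span (insert x B) \<or> span (insert y (span (insert x B))) \<in> H"
proof -
  have "x \<notin> span B" "dim B = k - 2"
    using assms by (simp_all add: grassmannian_def span_eq_iff[THEN iffD2])
  then have "dim (insert y (insert x B)) = k \<longleftrightarrow> y \<notin> span (insert x B)"
    using assms(2) by (auto simp: dim_insert)
  then show ?thesis
    unfolding residue_perp_def insert_commute[of x y] span_insert_span by auto
qed

text \<open>
  For \<open>x \<in> B\<close> every vector is perpendicular to \<open>x\<close>. Otherwise \<open>A = span (insert x B)\<close> is a
  \<open>(k - 1)\<close>-space and the points of \<open>x\<^sup>\<bottom>\<close> modulo \<open>A\<close> are the members of \<open>H\<close> through \<open>A\<close>. For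
  vectors \<open>y\<close>, \<open>z\<close> independent modulo \<open>A\<close> the \<open>k\<close>-spaces between \<open>A\<close> and
  \<open>span (A \<union> {y, z})\<close> form a line of the geometry: that \<open>H\<close> contains every line on which it has
  two points makes \<open>x\<^sup>\<bottom>\<close> additively closed, and that \<open>H\<close> meets every line gives codimension at
  most one.
\<close>

lemma null_polarity_residue:
  assumes H: "grassmann_hyperplane k UNIV H" and B: "B \<in> grassmannian (k - 2) UNIV"
    and k: "2 \<le> k"
  shows "null_polarity scale Basis (residue_perp k H B)"
proof unfold_locales
  let ?p = "residue_perp k H B"
  have dimB: "dim B = k - 2" using B by (simp add: grassmannian_def)
  have degenerate: "?p x y" if "x \<in> B" for x y
    by (rule residue_perp_base[OF B k that])
  have Suc_k: "Suc (k - 2) = k - 1" using k by simp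
  have A: "span (insert x B) \<in> grassmannian (k - 1) UNIV" if "x \<notin> B" for x
    using grassmannian_insert[OF B that] Suc_k by simp
  have point: "span (insert y A) \<in> grassmannian k UNIV"
    if "A \<in> grassmannian (k - 1) UNIV" "y \<notin> A" for y A
    using grassmannian_insert[OF that] k by simp
  have plane: "span (insert z (span (insert y A))) \<in> grassmannian (k + 1) UNIV"
    if "A \<in> grassmannian (k - 1) UNIV" "y \<notin> A" "z \<notin> span (insert y A)" for y z A
    using grassmannian_insert[OF point[OF that(1,2)] that(3)] by simp
  show "?p x x" for x
    using dimB k by (auto simp: residue_perp_def dim_insert)
  show "?p y x" if "?p x y" for x y
    using that by (simp add: residue_perp_def insert_commute)
  show "subspace {y. ?p x y}" for x
  proof (cases "x \<in> B")
    case True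
    then show ?thesis by (simp add: degenerate)
  next
    case False
    define A where "A = span (insert x B)"
    have A': "A \<in> grassmannian (k - 1) UNIV" and subA: "subspace A"
      using A[OF False] by (simp_all add: A_def)
    have perp: "?p x y \<longleftrightarrow> y \<in> A \<or> span (insert y A) \<in> H" for y
      using residue_perp_iff[OF B k False] by (simp add: A_def)
    have perp_in: "?p x y" if "X \<in> H" "X \<in> grassmannian k UNIV" "A \<subseteq> X" "y \<in> X" for X y
      using span_insert_eqI[OF A', of X UNIV y] that k by (auto simp: perp)
    have in_span: "a + b \<in> span (insert b A)" if "a \<in> A" for a b
      using that by (intro span_add) (auto intro: span_base)
    have add_in_A: "?p x (a + b)" if "a \<in> A" "?p x b" for a b
      using perp_in[OF _ point[OF A'] _ in_span[OF that(1)]] that subA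
      by (metis perp subspace_add insert_subset span_superset)
    show ?thesis
      unfolding subspace_def mem_Collect_eq
    proof (intro conjI allI ballI)
      show "?p x 0" using subA by (simp add: perp subspace_0)
    next
      fix c y assume "y \<in> {y. ?p x y}"
      then consider "y \<in> A" | "y \<notin> A" "span (insert y A) \<in> H"
        by (auto simp: perp)
      then show "?p x (scale c y)"
      proof cases
        case 1
        then show ?thesis using subA by (simp add: perp subspace_scale)
      next
        case 2
        have "A \<subseteq> span (insert y A)" by (auto intro: span_base)
        moreover have "scale c y \<in> span (insert y A)" by (intro span_scale span_base) simp
        ultimately show ?thesis
          using perp_in[OF 2(2) point[OF A' 2(1)]] by blast
      qed
    next
      fix y z assume "y \<in> {y. ?p x y}" "z \<in> {y. ?p x y}"
      then have y: "?p x y" and z: "?p x z" by auto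
      consider "y \<in> A" | "z \<in> A" | "y + z \<in> A" | "y \<notin> A" "z \<notin> A" "y + z \<notin> A" by blast
      then show "?p x (y + z)"
      proof cases
        case 1
        then show ?thesis using add_in_A z by blast
      next
        case 2
        then show ?thesis using add_in_A[of z y] y by (simp add: add.commute)
      next
        case 3
        then show ?thesis by (simp add: perp)
      next
        case 4
        have yH: "span (insert y A) \<in> H" and zH: "span (insert z A) \<in> H"
          using 4 y z by (auto simp: perp)
        show ?thesis
        proof (cases "z \<in> span (insert y A)")
          case True
          then have "y + z \<in> span (insert y A)"
            by (intro span_add) (auto intro: span_base)
          moreover have "A \<subseteq> span (insert y A)" by (auto intro: span_base)
          ultimately show ?thesis
            using perp_in[OF yH point[OF A' 4(1)]] by blast
        next
          case False
          let ?Z = "span (insert z (span (insert y A)))"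
          have Z: "?Z = span (insert z (insert y A))" by (rule span_insert_span)
          have "span (insert y A) \<noteq> span (insert z A)"
            using False by (metis insertI1 span_base)
          moreover have "span (insert (y + z) A) \<subseteq> ?Z"
            unfolding Z
          proof (rule span_minimal)
            have "y + z \<in> span (insert z (insert y A))"
              by (intro span_add) (auto intro: span_base)
            then show "insert (y + z) A \<subseteq> span (insert z (insert y A))"
              by (auto intro: span_base)
          qed simp
          moreover have "span (insert y A) \<subseteq> ?Z" "span (insert z A) \<subseteq> ?Z"
            unfolding Z by (rule span_mono, blast)+
          moreover have A_sub: "A \<subseteq> span (insert w A)" for w by (auto intro: span_base)
          ultimately have "span (insert (y + z) A) \<in> H"
            using hyperplane_contains_pencil[OF H A' plane[OF A' 4(1) False] yH A_sub _ zH A_sub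
                _ _ point[OF A' 4(3)] A_sub]
            by simp
          then show ?thesis by (simp add: perp)
        qed
      qed
    qed
  qed
  show "\<exists>c. ?p x (z - scale c y)" if nperp: "\<not> ?p x y" for x y z
  proof -
    have "x \<notin> B" using nperp degenerate by blast
    define A where "A = span (insert x B)"
    have A': "A \<in> grassmannian (k - 1) UNIV" and subA: "subspace A"
      using A[OF \<open>x \<notin> B\<close>] by (simp_all add: A_def)
    then have spanA: "span A = A" by (simp add: span_eq_iff[THEN iffD2])
    have perp: "?p x y \<longleftrightarrow> y \<in> A \<or> span (insert y A) \<in> H" for y
      using residue_perp_iff[OF B k \<open>x \<notin> B\<close>] by (simp add: A_def)
    have yA: "y \<notin> A" and yH: "span (insert y A) \<notin> H"
      using nperp by (auto simp: perp)
    show ?thesis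
    proof (cases "z \<in> span (insert y A)")
      case True
      then obtain c where "z - scale c y \<in> A"
        by (auto simp: span_insert spanA)
      then show ?thesis by (auto simp: perp)
    next
      case False
      let ?Z = "span (insert z (span (insert y A)))"
      have "A \<subseteq> ?Z" by (auto intro!: span_base)
      then obtain X where X: "X \<in> H" "X \<in> grassmannian k UNIV" "A \<subseteq> X" "X \<subseteq> ?Z"
        using hyperplane_meets_pencil[OF H A' plane[OF A' yA False]] by blast
      have subX: "subspace X" using X(2) by (simp add: grassmannian_def)
      have spanX: "span (insert w A) = X" if "w \<in> X" "w \<notin> A" for w
        using span_insert_eqI[OF A', of X UNIV w] X that k by simp
      have "\<not> X \<subseteq> span (insert y A)"
        using subspace_dim_equal[of X "span (insert y A)"] X point[OF A' yA] yH subX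
        by (auto simp: grassmannian_def)
      then obtain w where w: "w \<in> X" "w \<notin> span (insert y A)" by blast
      then obtain d where d: "w - scale d z \<in> span (insert y A)"
        using X(4) by (auto simp: span_insert[of z] span_span)
      with w(2) have "d \<noteq> 0" by auto
      obtain c where c: "w - scale d z - scale c y \<in> A"
        using d by (auto simp: span_insert[of y] spanA)
      \<comment> \<open>\<open>X\<close> contains \<open>d z + c y\<close> with \<open>d \<noteq> 0\<close>, hence also \<open>z - (- c / d) y\<close>.\<close>
      have "scale (inverse d) (w - (w - scale d z - scale c y)) \<in> X"
        using subspace_scale[OF subX subspace_diff[OF subX w(1)]] c X(3) by blast
      then have "z - scale (- inverse d * c) y \<in> X"
        using \<open>d \<noteq> 0\<close> by (simp add: scale_right_distrib add.commute)
      then show ?thesis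
        using spanX X(1) perp by metis
    qed
  qed
qed

text \<open>
  A \<open>(k - 1)\<close>-space through \<open>B\<close> is spanned by \<open>B\<close> and any of its vectors outside \<open>B\<close>, so one
  such vector decides membership in the upper radical.
\<close>

lemma mem_upper_radical_iff:
  assumes B: "B \<in> grassmannian (k - 2) W" and k: "2 \<le> k" and W: "subspace W"
    and a: "a \<in> W" "a \<notin> B"
  shows "span (insert a B) \<in> upper_radical k W (restrict_to k H W) \<longleftrightarrow>
    (\<forall>w\<in>W. residue_perp k H B a w)"
proof -
  have B': "B \<in> grassmannian (k - 2) UNIV" and BW: "B \<subseteq> W"
    using B by (auto simp: grassmannian_def)
  define A where "A = span (insert a B)"
  have Suc_k: "Suc (k - 2) = k - 1" using k by simp
  have A': "A \<in> grassmannian (k - 1) UNIV"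
    using grassmannian_insert[OF B' a(2)] Suc_k by (simp add: A_def)
  have AW: "A \<subseteq> W"
    unfolding A_def using a BW W by (intro span_minimal) auto
  have perp: "residue_perp k H B a w \<longleftrightarrow> w \<in> A \<or> span (insert w A) \<in> H" for w
    using residue_perp_iff[OF B' k a(2)] by (simp add: A_def)
  have point: "span (insert w A) \<in> grassmannian k W" if "w \<in> W" "w \<notin> A" for w
    using grassmannian_insert[OF A' that(2)] k span_minimal[of "insert w A" W] W AW that
    by (simp add: grassmannian_def)
  have "A \<in> upper_radical k W (restrict_to k H W) \<longleftrightarrow> (\<forall>w\<in>W. residue_perp k H B a w)"
  proof
    assume l: "A \<in> upper_radical k W (restrict_to k H W)"
    show "\<forall>w\<in>W. residue_perp k H B a w"
    proof
      fix w assume "w \<in> W"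
      moreover have "A \<subseteq> span (insert w A)" by (auto intro: span_base)
      ultimately show "residue_perp k H B a w"
        using l point[of w] unfolding perp by (auto simp: upper_radical_def restrict_to_def)
    qed
  next
    assume r: "\<forall>w\<in>W. residue_perp k H B a w"
    have "X \<in> H" if X: "X \<in> grassmannian k W" "A \<subseteq> X" for X
    proof -
      have "A \<noteq> X" using A' X(1) k by (auto simp: grassmannian_def)
      then obtain w where w: "w \<in> X" "w \<notin> A" using X(2) by blast
      moreover have "span (insert w A) = X"
        using span_insert_eqI[OF A', of X W w] X w k by simp
      moreover have "w \<in> W" using w(1) X(1) by (auto simp: grassmannian_def)
      ultimately show ?thesis using r perp by metis
    qed
    then show "A \<in> upper_radical k W (restrict_to k H W)"
      using A' AW by (auto simp: upper_radical_def restrict_to_def grassmannian_def)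
  qed
  then show ?thesis by (simp add: A_def)
qed

lemma grassmannian_extend:
  assumes "subspace U" "dim U \<le> m" "m \<le> dim UNIV"
  obtains X where "X \<in> grassmannian m UNIV" "U \<subseteq> X"
proof -
  have "\<exists>X. X \<in> grassmannian m UNIV \<and> U \<subseteq> X"
    using assms(2,3)
  proof (induction m rule: dec_induct)
    case base
    then show ?case using assms(1) by (auto simp: grassmannian_def)
  next
    case (step m)
    then obtain X where X: "X \<in> grassmannian m UNIV" "U \<subseteq> X" by auto
    have "X \<noteq> UNIV" using X(1) step.hyps step.prems by (auto simp: grassmannian_def)
    then obtain x where "x \<notin> X" by blast
    then show ?case
      using grassmannian_insert[OF X(1)] X(2) by (meson insert_subset span_superset subset_trans)
  qed
  then show thesis using that by blast
qed

section \<open>Empty upper radicals and spread-like restrictions\<close>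

text \<open>
  Given \<open>B\<close>, existence of a member of the upper radical through \<open>B\<close> is forced by parity;
  uniqueness holds because otherwise a combination of two independent radical vectors of \<open>W\<close> would
  also be perpendicular to a vector outside \<open>W\<close>, hence to all of \<open>V\<close>.
\<close>

lemma spread_like_if_upper_radical_empty:
  assumes H: "grassmann_hyperplane k UNIV H" and k: "2 \<le> k" "k < dim UNIV"
    and even: "even (dim UNIV - k)"
    and empty: "upper_radical k UNIV H = {}" and W: "W \<in> grassmannian (dim UNIV - 1) UNIV"
  shows "spread_like k W (upper_radical k W (restrict_to k H W))"
  unfolding spread_like_def
proof
  fix B assume B: "B \<in> grassmannian (k - 2) W"
  then have B': "B \<in> grassmannian (k - 2) UNIV" and BW: "B \<subseteq> W"
    by (auto simp: grassmannian_def)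
  have subW: "subspace W" and dimW: "dim W = dim UNIV - 1"
    using W by (auto simp: grassmannian_def)
  have Suc_k: "Suc (k - 2) = k - 1" using k by simp
  interpret null_polarity scale Basis "residue_perp k H B"
    by (rule null_polarity_residue[OF H B' k(1)])
  let ?p = "residue_perp k H B"
  let ?R = "upper_radical k W (restrict_to k H W)"
  have radV: "x \<in> B" if "\<forall>y. ?p x y" for x
    using mem_upper_radical_iff[OF B' k(1) subspace_UNIV, of x H] that empty by (auto simp: restrict_to_UNIV[OF H])
  have B_rad: "B \<subseteq> radical W"
    using residue_perp_base[OF B' k(1)] BW by (auto simp: radical_def)
  have "radical W \<noteq> B"
  proof
    assume "radical W = B"
    then have "even (dim UNIV - 1 - (k - 2))"
      using even_dim_diff_radical[OF subW] dimW B by (simp add: grassmannian_def)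
    moreover have "dim UNIV - 1 - (k - 2) = Suc (dim UNIV - k)"
      using k by simp
    ultimately show False using even by (metis even_Suc)
  qed
  then obtain a where a: "a \<in> radical W" "a \<notin> B" using B_rad by blast
  then have aW: "a \<in> W" and a_perp: "\<forall>w\<in>W. ?p a w" by (auto simp: radical_def)
  have "span (insert a B) \<in> ?R"
    using mem_upper_radical_iff[OF B k(1) subW aW a(2)] a_perp by blast
  moreover have "B \<subseteq> span (insert a B)" by (auto intro: span_base)
  moreover have "A = span (insert a B)" if A: "A \<in> ?R" "B \<subseteq> A" for A
  proof -
    have A': "A \<in> grassmannian (Suc (k - 2)) W"
      unfolding Suc_k using A(1) by (simp add: upper_radical_def)
    have "A \<noteq> B" using A' B by (auto simp: grassmannian_def)
    then obtain a' where a': "a' \<in> A" "a' \<notin> B" using A(2) by blast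
    have A_eq: "span (insert a' B) = A"
      using span_insert_eqI[OF B' A' A(2) a'] .
    have a'W: "a' \<in> W" using A' a' by (auto simp: grassmannian_def)
    have a'_perp: "\<forall>w\<in>W. ?p a' w"
      using mem_upper_radical_iff[OF B k(1) subW a'W a'(2), of H] A(1) A_eq by simp
    have "W \<noteq> UNIV" using dimW k by auto
    then obtain v where v: "v \<notin> W" by blast
    have V: "span (insert v W) = UNIV"
      using grassmannian_insert[OF W v] k
      by (intro subspace_dim_equal) (auto simp: grassmannian_def)
    \<comment> \<open>A vector perpendicular to \<open>W\<close> and to \<open>v\<close> is perpendicular to their span \<open>V\<close>.\<close>
    have to_B: "x \<in> B" if "\<forall>w\<in>W. ?p x w" "?p x v" for x
    proof (rule radV)
      have "span (insert v W) \<subseteq> {y. ?p x y}"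
        using that by (intro span_minimal subspace_perp) auto
      then show "\<forall>y. ?p x y" using V by auto
    qed
    have "\<not> ?p v a" using to_B a_perp a(2) perp_sym by blast
    then obtain c where c: "?p v (a' - scale c a)" using perp_codim by blast
    have "?p (a' - scale c a) w" if "w \<in> W" for w
      using that a_perp a'_perp by (meson perp_sym perp_diff perp_scale)
    then have "a' - scale c a \<in> B" using to_B c perp_sym by blast
    then have "(a' - scale c a) + scale c a \<in> span (insert a B)"
      by (intro span_add span_scale) (auto intro: span_base)
    then have "A \<subseteq> span (insert a B)"
      unfolding A_eq[symmetric] by (intro span_minimal) (auto intro: span_base)
    moreover have "dim (span (insert a B)) = dim A"
      using grassmannian_insert[OF B' a(2)] A' by (simp add: grassmannian_def)
    ultimately show ?thesis
      using A' by (intro subspace_dim_equal) (auto simp: grassmannian_def)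
  qed
  ultimately show "\<exists>!A. A \<in> ?R \<and> B \<subseteq> A" by blast
qed

text \<open>
  Parity makes the radical of \<open>V\<close> exceed \<open>B\<close> by two dimensions as soon as it exceeds \<open>B\<close> at all,
  and vectors of it lying in \<open>W\<close> stay in the radical of \<open>W\<close>.
\<close>

lemma upper_radical_empty_if_spread_like:
  assumes H: "grassmann_hyperplane k UNIV H" and k: "2 \<le> k" "k < dim UNIV"
    and even: "even (dim UNIV - k)"
    and spread: "\<And>W. W \<in> grassmannian (dim UNIV - 1) UNIV \<Longrightarrow>
      spread_like k W (upper_radical k W (restrict_to k H W))"
  shows "upper_radical k UNIV H = {}"
proof (rule ccontr)
  assume "upper_radical k UNIV H \<noteq> {}"
  then obtain A where A: "A \<in> upper_radical k UNIV H" by blast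
  have Suc_k: "Suc (k - 2) = k - 1" using k by simp
  have A': "A \<in> grassmannian (Suc (k - 2)) UNIV"
    unfolding Suc_k using A by (simp add: upper_radical_def)
  then have subA: "subspace A" and dimA: "dim A = Suc (k - 2)" by (auto simp: grassmannian_def)
  obtain B where B: "subspace B" "B \<subseteq> span A" "dim B = k - 2"
    using choose_subspace_of_subspace[of "k - 2" A] dimA by auto
  then have B': "B \<in> grassmannian (k - 2) UNIV" and BA: "B \<subseteq> A"
    using subA by (auto simp: grassmannian_def span_eq_iff[THEN iffD2])
  interpret null_polarity scale Basis "residue_perp k H B"
    by (rule null_polarity_residue[OF H B' k(1)])
  let ?p = "residue_perp k H B"
  have A_perp: "?p a y" if "a \<in> A" for a y
  proof (cases "a \<in> B")
    case True
    then show ?thesis by (rule residue_perp_base[OF B' k(1)])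
  next
    case False
    then show ?thesis
      using mem_upper_radical_iff[OF B' k(1) subspace_UNIV UNIV_I False, of H] A
        span_insert_eqI[OF B' A' BA that False]
      by (simp add: restrict_to_UNIV[OF H])
  qed
  have "radical UNIV \<noteq> A"
  proof
    assume "radical UNIV = A"
    then have "even (dim UNIV - Suc (k - 2))"
      using even_dim_diff_radical[OF subspace_UNIV] dimA by simp
    moreover have "dim UNIV - Suc (k - 2) = Suc (dim UNIV - k)"
      using k by simp
    ultimately show False using even by (metis even_Suc)
  qed
  moreover have "A \<subseteq> radical UNIV" using A_perp by (auto simp: radical_def)
  ultimately obtain a' where a': "a' \<in> radical UNIV" "a' \<notin> A" by blast
  have "A \<noteq> B" using dimA B(3) by auto
  then obtain a where a: "a \<in> A" "a \<notin> B" using BA by blast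
  have "dim (span (insert a' A)) \<le> dim UNIV - 1"
    using grassmannian_insert[OF A' a'(2)] k by (simp add: grassmannian_def)
  then obtain W where W: "W \<in> grassmannian (dim UNIV - 1) UNIV" and sub: "span (insert a' A) \<subseteq> W"
    using grassmannian_extend[OF subspace_span _ diff_le_self] by blast
  have AW: "A \<subseteq> W" and a'W: "a' \<in> W" using sub by (auto intro: span_base)
  have BW: "B \<in> grassmannian (k - 2) W"
    using B' BA AW by (auto simp: grassmannian_def)
  have subW: "subspace W" using W by (simp add: grassmannian_def)
  have a'B: "a' \<notin> B" using a'(2) BA by blast
  let ?R = "upper_radical k W (restrict_to k H W)"
  have "span (insert a B) \<in> ?R"
    using mem_upper_radical_iff[OF BW k(1) subW _ a(2)] AW a(1) A_perp by blast
  moreover have "span (insert a' B) \<in> ?R"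
    using mem_upper_radical_iff[OF BW k(1) subW a'W a'B] a'(1) by (auto simp: radical_def)
  moreover have "B \<subseteq> span (insert a B)" "B \<subseteq> span (insert a' B)"
    by (auto intro: span_base)
  ultimately have "span (insert a B) = span (insert a' B)"
    using spread[OF W] BW unfolding spread_like_def by blast
  moreover have "span (insert a B) = A"
    using span_insert_eqI[OF B' A' BA a] .
  moreover have "a' \<in> span (insert a' B)" by (simp add: span_base)
  ultimately show False using a'(2) by simp
qed

end

theorem proposition1p3:
  fixes scale :: "'k::field \<Rightarrow> 'v::ab_group_add \<Rightarrow> 'v"
    and Basis :: "'v set"
    and n k :: nat
    and H :: "'v set set"
  assumes "finite_dimensional_vector_space scale Basis"
    and "vector_space.dim scale (UNIV :: 'v set) = n"
    and "3 \<le> k" and "k < n - 1" and "even (n - k)"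
    and "vector_space.grassmann_hyperplane scale k UNIV H"
  shows "vector_space.upper_radical scale k UNIV H = {} \<longleftrightarrow>
    (\<forall>W \<in> vector_space.grassmannian scale (n - 1) UNIV.
       vector_space.spread_like scale k W
         (vector_space.upper_radical scale k W (vector_space.restrict_to scale k H W)))"
proof -
  interpret finite_dimensional_vector_space scale Basis by fact
  have k: "2 \<le> k" "k < dim UNIV" "even (dim UNIV - k)"
    using assms by auto
  show ?thesis
    using spread_like_if_upper_radical_empty[OF assms(6) k]
      upper_radical_empty_if_spread_like[OF assms(6) k] assms(2)
    by blast
qed

end
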